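(* Let $F$ be a CNF formula over $n$ Boolean variables with a fixed variable ordering, let $i\ge 0$ and $\ell\ge 1$ be integers with $i+\ell\le n$, let $M=2^\ell$, and let $k>1$ be an integer. Let $S_i$ and $S_{i+\ell}$ be the sets of pseudosolutions of $F$ of levels $i$ and $i+\ell$. Let $\Phi\subseteq S_i$ be a random set of uniformly sampled pseudosolutions of level $i$ with $|\Phi|\ge \min\{k,|S_i|\}$, and let $S\subseteq S_{i+\ell}$ be the (random) output of the procedure BlackBoxSampler$(\Phi,k,\ell)$. For $s\in S_{i+\ell}$ let $P(s)$ be the probability (over the choice of $\Phi$, the randomness of the procedure, and the final draw) that an element drawn uniformly at random from $S$ is equal to $s$. Then for any two pseudosolutions $s,s'\in S_{i+\ell}$, $$\frac{k}{M+k-1}\;\le\;\frac{P(s)}{P(s')}\;\le\;\frac{M+k-1}{k}.$$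
   Context: Let $F$ be a CNF formula over $n$ Boolean variables, listed in a fixed order $x_1,\dots,x_n$. A solution of $F$ is a truth assignment in $\{0,1\}^n$ satisfying all clauses of $F$. For $0\le i\le n$, a pseudosolution of level $i$ is a truth assignment to the first $i$ variables that can be completed (by assigning the remaining $n-i$ variables) to a solution of $F$. $S_i$ denotes the set of pseudosolutions of level $i$. For $t\in S_i$, $D(t)$ denotes the set of all pseudosolutions of level $i+\ell$ whose restriction to the first $i$ variables is $t$ (those having $t$ as ancestor). "$\Phi$ is a set of uniformly sampled pseudosolutions of level $i$" means: $\Phi$ is a random subset of $S_i$ such that, conditionally on its cardinality, all subsets of $S_i$ of that cardinality are equally likely (uniform sampling without replacement). Procedure BlackBoxSampler$(\Phi,k,\ell)$: start with $S=\emptyset$. For $j=1,\dots,\min\{k,|\Phi|\}$: draw $s_j$ uniformly at random from $\Phi$ without replacement (independently of everything else), and replace $S$ by $S\cup D(s_j)$. Return $S$. *)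

theory Defs
  imports "HOL-Probability.Probability"
begin

text \<open>
  Variables are numbered from 0 in the fixed order, so a truth assignment to the first \<open>i\<close>
  variables is a Boolean list of length \<open>i\<close>, and restriction to the first \<open>i\<close> variables is
  \<open>take i\<close>.
\<close>

datatype literal = Pos (lvar: nat) | Neg (lvar: nat)

type_synonym clause = "literal list"
type_synonym cnf = "clause list"

definition cnf_over :: "nat \<Rightarrow> cnf \<Rightarrow> bool" where
  "cnf_over n F \<longleftrightarrow> (\<forall>C\<in>set F. \<forall>L\<in>set C. lvar L < n)"

fun sat_literal :: "bool list \<Rightarrow> literal \<Rightarrow> bool" where
  "sat_literal a (Pos x) \<longleftrightarrow> a ! x"
| "sat_literal a (Neg x) \<longleftrightarrow> \<not> a ! x"

definition sat_clause :: "bool list \<Rightarrow> clause \<Rightarrow> bool" where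
  "sat_clause a C \<longleftrightarrow> (\<exists>L\<in>set C. sat_literal a L)"

definition solutions :: "nat \<Rightarrow> cnf \<Rightarrow> bool list set" where
  "solutions n F = {a. length a = n \<and> (\<forall>C\<in>set F. sat_clause a C)}"

definition pseudosolutions :: "nat \<Rightarrow> cnf \<Rightarrow> nat \<Rightarrow> bool list set" where
  "pseudosolutions n F i = {t. length t = i \<and> (\<exists>u. t @ u \<in> solutions n F)}"

text \<open>The level of \<open>t\<close> is \<open>length t\<close>.\<close>

definition descendants :: "nat \<Rightarrow> cnf \<Rightarrow> nat \<Rightarrow> bool list \<Rightarrow> bool list set" where
  "descendants n F l t = {u \<in> pseudosolutions n F (length t + l). take (length t) u = t}"

text \<open>
  A random subset is represented by its distribution. Cardinalities of sets outside the support
  are values taken with probability 0, on which there is nothing to condition.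
\<close>

definition uniformly_sampled :: "'a set \<Rightarrow> 'a set pmf \<Rightarrow> bool" where
  "uniformly_sampled A p \<longleftrightarrow>
     (\<forall>\<Phi>\<in>set_pmf p. \<Phi> \<subseteq> A) \<and>
     (\<forall>\<Phi>\<in>set_pmf p.
        cond_pmf p {B. card B = card \<Phi>} = pmf_of_set {B. B \<subseteq> A \<and> card B = card \<Phi>})"

text \<open>
  \<open>sampler_loop D j \<Phi> S\<close> performs \<open>j\<close> further iterations, where \<open>\<Phi>\<close> holds the elements not yet
  drawn and \<open>S\<close> is the union accumulated so far; it is meant for \<open>j \<le> card \<Phi>\<close>.
\<close>

primrec sampler_loop ::
  "('a \<Rightarrow> 'b set) \<Rightarrow> nat \<Rightarrow> 'a set \<Rightarrow> 'b set \<Rightarrow> 'b set pmf" where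
  "sampler_loop D 0 \<Phi> S = return_pmf S"
| "sampler_loop D (Suc j) \<Phi> S =
     bind_pmf (pmf_of_set \<Phi>) (\<lambda>s. sampler_loop D j (\<Phi> - {s}) (S \<union> D s))"

definition black_box_sampler ::
  "nat \<Rightarrow> cnf \<Rightarrow> bool list set \<Rightarrow> nat \<Rightarrow> nat \<Rightarrow> bool list set pmf" where
  "black_box_sampler n F \<Phi> k l =
     sampler_loop (descendants n F l) (min k (card \<Phi>)) \<Phi> {}"

text \<open>
  The distribution of a uniform draw from the output of the sampler, when its input is itself
  random with distribution \<open>p\<close>.
\<close>

definition black_box_draw ::
  "nat \<Rightarrow> cnf \<Rightarrow> bool list set pmf \<Rightarrow> nat \<Rightarrow> nat \<Rightarrow> bool list pmf" where
  "black_box_draw n F p k l =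
     bind_pmf p (\<lambda>\<Phi>. bind_pmf (black_box_sampler n F \<Phi> k l) pmf_of_set)"

end

theory Submission
  imports Defs
begin

text \<open>
  The set of ancestors drawn by the sampler has a distribution that is invariant under every
  transposition of two pseudosolutions of level \<open>i\<close>. Hence the event that the ancestor \<open>t\<close> of
  \<open>s\<close> is drawn can be compared pointwise with the event that the ancestor \<open>t'\<close> of \<open>s'\<close> is drawn:
  exchanging \<open>t\<close> for \<open>t'\<close> in the drawn set only changes one summand, between \<open>1\<close> and \<open>M\<close>, of the
  size of the output, while the other \<open>k - 1\<close> summands are at least \<open>1\<close>.
\<close>

section \<open>Exchanging two elements in sums and in uniformly sampled sets\<close>

lemma transpose_image_insert:
  assumes "t \<notin> B" "t' \<notin> B"
  shows "Transposition.transpose t t' ` insert t B = insert t' B"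
proof -
  have "Transposition.transpose t t' ` B = B"
    using assms by (intro transpose_image_eq) auto
  then show ?thesis by simp
qed

text \<open>In the application \<open>d x\<close> is the number of descendants of \<open>x\<close>,
  and the two sums are output sizes before and after the exchange. If \<open>t'\<close> is already
  in \<open>A\<close>, the exchange changes nothing and k \<le> M + k - 1 suffices.\<close>

lemma sum_transpose_image_le:
  fixes d :: "'a \<Rightarrow> nat"
  assumes "finite T" "A \<subseteq> T" "card A = min k (card T)" "t \<in> A" "t' \<in> T"
    and d: "\<And>x. x \<in> T \<Longrightarrow> 1 \<le> d x \<and> d x \<le> M"
  shows "k * sum d (Transposition.transpose t t' ` A) \<le> (M + k - 1) * sum d A"
proof -
  have "t \<in> T" using assms by auto
  then obtain m where M: "M = Suc m"
    using d[of t] by (cases M) auto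
  have [simp]: "finite A" using assms finite_subset by blast
  show ?thesis
  proof (cases "t' \<in> A")
    case True
    then have "Transposition.transpose t t' ` A = A"
      using \<open>t \<in> A\<close> by (intro transpose_image_eq) auto
    then show ?thesis by (simp add: M)
  next
    case False
    \<comment> \<open>Missing \<open>t'\<close>, the set \<open>A\<close> is not all of
      \<open>T\<close>, so the minimum is \<open>k\<close> and exactly k - 1 elements remain beside
      \<open>t\<close>.\<close>
    then have "card A \<noteq> card T"
      using assms card_subset_eq by blast
    then have "card A = k" using assms by simp
    define B where "B = A - {t}"
    have A: "A = insert t B" "t \<notin> B" "t' \<notin> B" "finite B"
      using False \<open>t \<in> A\<close> by (auto simp: B_def)
    have k: "k = Suc (card B)" using \<open>card A = k\<close> A by simp
    have "card B \<le> sum d B"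
      using sum_mono[of B "\<lambda>_. 1" d] d \<open>A \<subseteq> T\<close> A(1) by auto
    \<comment> \<open>With this excess \<open>c\<close>, the two sides of the decisive inequality
      below differ by exactly \<open>m * c\<close>; writing \<open>M = Suc m\<close> avoids
      truncated subtraction.\<close>
    then obtain c where c: "sum d B = card B + c"
      using le_Suc_ex by blast
    have "k * sum d (Transposition.transpose t t' ` A) = k * (d t' + sum d B)"
      using A by (simp add: transpose_image_insert)
    also have "\<dots> \<le> k * (M + sum d B)"
      using d \<open>t' \<in> T\<close> by simp
    also have "\<dots> \<le> (M + k - 1) * (1 + sum d B)"
      by (simp add: c k M algebra_simps)
    also have "\<dots> \<le> (M + k - 1) * sum d A"
      unfolding A(1) using A(2,4) d[OF \<open>t \<in> T\<close>] by (intro mult_le_mono2) simp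
    finally show ?thesis .
  qed
qed

text \<open>A bijection preserves cardinality, so \<open>B\<close> and its image are equally likely
  under the same conditional law, hence also under \<open>p\<close>.\<close>

lemma uniformly_sampled_image_invariant:
  assumes p: "uniformly_sampled A p" and "finite A" and \<pi>: "bij \<pi>" "\<pi> ` A = A"
  shows "map_pmf ((`) \<pi>) p = p"
proof (rule pmf_eqI)
  have image_eq: "pmf p (\<sigma> ` B) = pmf p B"
    if B: "B \<in> set_pmf p" and \<sigma>: "inj \<sigma>" "\<sigma> ` A = A" for \<sigma> B
  proof -
    let ?C = "{X. card X = card B}" and ?E = "{X. X \<subseteq> A \<and> card X = card B}"
    have ne: "set_pmf p \<inter> ?C \<noteq> {}" using B by auto
    have cond: "cond_pmf p ?C = pmf_of_set ?E" and BA: "B \<subseteq> A"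
      using p B by (auto simp: uniformly_sampled_def)
    have "finite ?E" using \<open>finite A\<close> by simp
    have E: "B \<in> ?E" "\<sigma> ` B \<in> ?E"
      using BA \<sigma> by (auto intro: card_image inj_on_subset)
    then have "pmf (cond_pmf p ?C) B = pmf (cond_pmf p ?C) (\<sigma> ` B)"
      unfolding cond using \<open>finite ?E\<close> by (subst (1 2) pmf_of_set) auto
    moreover have "measure p ?C > 0"
      using B by (intro measure_pmf_posI) auto
    ultimately show ?thesis
      using ne E by (simp add: pmf_cond)
  qed
  fix B
  have eq: "pmf p (\<pi> ` X) = pmf p X" for X
  proof (cases "X \<in> set_pmf p")
    case True
    then show ?thesis using image_eq \<pi> bij_is_inj by blast
  next
    case False
    \<comment> \<open>Uniformity only speaks of sets in the support. Were the image of
      \<open>X\<close> there, applying \<open>inv \<pi>\<close> would put \<open>X\<close> there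
      too.\<close>
    have inv: "inv \<pi> ` \<pi> ` X = X" "inv \<pi> ` A = A" "inj (inv \<pi>)"
      using \<pi> by (metis bij_is_inj image_inv_f_f, metis bij_is_inj image_inv_f_f,
          simp add: bij_imp_bij_inv bij_is_inj)
    then have "\<pi> ` X \<notin> set_pmf p"
      using image_eq[of "\<pi> ` X" "inv \<pi>"] False by (metis set_pmf_iff)
    then show ?thesis using False by (simp add: set_pmf_iff)
  qed
  have "inj ((`) \<pi>)" using \<pi>(1) by (simp add: bij_is_inj inj_image_eq_iff inj_on_def[of "(`) \<pi>"])
  moreover have "B = \<pi> ` inv \<pi> ` B"
    using \<pi> by (simp add: bij_is_surj image_f_inv_f)
  ultimately show "pmf (map_pmf ((`) \<pi>) p) B = pmf p B"
    using eq by (metis pmf_map_inj')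
qed

section \<open>The law of the drawn set and of a uniform draw from its union\<close>

text \<open>With singletons for \<open>D\<close>, the loop returns the set of drawn elements.\<close>

abbreviation draw_loop :: "nat \<Rightarrow> 'a set \<Rightarrow> 'a set \<Rightarrow> 'a set pmf" where
  "draw_loop \<equiv> sampler_loop (\<lambda>x. {x})"

lemma sampler_loop_eq_map_draw_loop:
  "sampler_loop D j \<Phi> (\<Union>(D ` S)) = map_pmf (\<lambda>A. \<Union>(D ` A)) (draw_loop j \<Phi> S)"
proof (induction j arbitrary: \<Phi> S)
  case (Suc j)
  show ?case
    using Suc[of _ "insert _ S"] by (simp add: map_bind_pmf Un_commute)
qed simp

text \<open>Injectivity makes relabelling commute both with a uniform draw and with removal of the
  drawn element. The bound on \<open>j\<close> keeps the pool nonempty, where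
  \<open>pmf_of_set\<close> is meaningful.\<close>

lemma map_draw_loop:
  assumes "inj \<pi>" "finite \<Phi>" "j \<le> card \<Phi>"
  shows "map_pmf ((`) \<pi>) (draw_loop j \<Phi> S) = draw_loop j (\<pi> ` \<Phi>) (\<pi> ` S)"
  using assms(2,3)
proof (induction j arbitrary: \<Phi> S)
  case (Suc j)
  then have ne: "\<Phi> \<noteq> {}" by auto
  have step: "map_pmf ((`) \<pi>) (draw_loop j (\<Phi> - {x}) (S \<union> {x}))
      = draw_loop j (\<pi> ` \<Phi> - {\<pi> x}) (\<pi> ` S \<union> {\<pi> x})" if "x \<in> \<Phi>" for x
    using that Suc.prems \<open>inj \<pi>\<close>
    by (subst Suc.IH) (auto simp: image_set_diff image_Un)
  have "pmf_of_set (\<pi> ` \<Phi>) = map_pmf \<pi> (pmf_of_set \<Phi>)"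
    using ne Suc.prems \<open>inj \<pi>\<close>
    by (intro map_pmf_of_set_inj[symmetric]) (auto intro: inj_on_subset)
  then show ?case
    using ne Suc.prems step
    by (auto simp: map_bind_pmf bind_map_pmf set_pmf_of_set[OF ne] intro!: bind_pmf_cong[OF refl])
qed simp

lemma set_draw_loop:
  assumes "finite \<Phi>" "finite S" "j \<le> card \<Phi>" "S \<inter> \<Phi> = {}" "A \<in> set_pmf (draw_loop j \<Phi> S)"
  shows "A \<subseteq> S \<union> \<Phi> \<and> card A = card S + j"
  using assms
proof (induction j arbitrary: \<Phi> S)
  case (Suc j)
  then have "\<Phi> \<noteq> {}" by auto
  then obtain x where x: "x \<in> \<Phi>" "A \<in> set_pmf (draw_loop j (\<Phi> - {x}) (S \<union> {x}))"
    using Suc.prems by auto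
  have "A \<subseteq> (S \<union> {x}) \<union> (\<Phi> - {x}) \<and> card A = card (S \<union> {x}) + j"
    using x Suc.prems by (intro Suc.IH) auto
  moreover have "x \<notin> S" using x Suc.prems by auto
  ultimately show ?case using x Suc.prems by auto
qed simp

text \<open>The bound holds for each \<open>A\<close> against its exchanged set; averaging over
  \<open>q\<close> and using invariance removes the exchange. Disjointness of the \<open>D x\<close>
  makes output sizes additive.\<close>

lemma pmf_bind_union_le:
  fixes q :: "'a set pmf" and D :: "'a \<Rightarrow> 'b set"
  assumes "finite T" "k > 0"
    and q: "\<And>A. A \<in> set_pmf q \<Longrightarrow> A \<subseteq> T \<and> card A = min k (card T)"
    and inv: "map_pmf ((`) (Transposition.transpose t t')) q = q"
    and D: "\<And>x. x \<in> T \<Longrightarrow> finite (D x) \<and> 1 \<le> card (D x) \<and> card (D x) \<le> M"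
    and disj: "disjoint_family_on D T"
    and s: "t \<in> T" "t' \<in> T" "s \<in> D t" "s' \<in> D t'"
  shows "pmf (bind_pmf q (\<lambda>A. pmf_of_set (\<Union>(D ` A)))) s
      \<le> (real M + real k - 1) / real k * pmf (bind_pmf q (\<lambda>A. pmf_of_set (\<Union>(D ` A)))) s'"
proof -
  let ?\<pi> = "Transposition.transpose t t'" and ?f = "\<lambda>A. pmf_of_set (\<Union>(D ` A))"
  let ?c = "(real M + real k - 1) / real k"
  have M: "M \<ge> 1" using D s by force
  have bound: "pmf (?f A) s \<le> ?c * pmf (?f (?\<pi> ` A)) s'" if "A \<in> set_pmf q" for A
  proof -
    have A: "A \<subseteq> T" "card A = min k (card T)" using q that by auto
    have "?\<pi> ` A \<subseteq> T" using A s by (auto simp: Transposition.transpose_def)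
    have ne: "A \<noteq> {}" using A s \<open>finite T\<close> \<open>k > 0\<close> by (auto simp: min_def split: if_splits)
    have card: "card (\<Union>(D ` B)) = (\<Sum>x\<in>B. card (D x))" if "B \<subseteq> T" for B
      using that D disj finite_subset[OF that \<open>finite T\<close>]
      by (intro card_UN_disjoint) (auto simp: disjoint_family_on_def subset_iff)
    have fin: "finite (\<Union>(D ` B))" if "B \<subseteq> T" for B
      using that D finite_subset[OF that \<open>finite T\<close>] by auto
    have nonempty: "\<Union>(D ` B) \<noteq> {}" if "B \<subseteq> T" "B \<noteq> {}" for B
      using that D by fastforce
    have pmf: "pmf (?f B) x = indicator (\<Union>(D ` B)) x / card (\<Union>(D ` B))"
      if "B \<subseteq> T" "B \<noteq> {}" for B x
      using that fin nonempty by (intro pmf_of_set) auto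
    show ?thesis
    proof (cases "t \<in> A")
      case False
      \<comment> \<open>By disjointness \<open>s\<close> can only come from \<open>t\<close>, so the
        left side is 0.\<close>
      then have "s \<notin> \<Union>(D ` A)"
        using disj s A by (fastforce simp: disjoint_family_on_def)
      then show ?thesis using A ne pmf M by simp
    next
      case True
      let ?a = "card (\<Union>(D ` A))" and ?b = "card (\<Union>(D ` ?\<pi> ` A))"
      have "s \<in> \<Union>(D ` A)" using True s by auto
      moreover have "t' \<in> ?\<pi> ` A" using imageI[OF True, of ?\<pi>] by simp
      then have "s' \<in> \<Union>(D ` ?\<pi> ` A)" using s by blast
      ultimately have eq: "pmf (?f A) s = 1 / ?a" "pmf (?f (?\<pi> ` A)) s' = 1 / ?b"
        using pmf[OF A(1) ne] pmf[OF \<open>?\<pi> ` A \<subseteq> T\<close>] ne by auto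
      have "?\<pi> ` A \<noteq> {}" using ne by simp
      then have pos: "?a > 0" "?b > 0"
        using nonempty[OF A(1) ne] fin[OF A(1)]
          nonempty[OF \<open>?\<pi> ` A \<subseteq> T\<close>] fin[OF \<open>?\<pi> ` A \<subseteq> T\<close>]
        by (metis card_gt_0_iff)+
      have "k * ?b \<le> (M + k - 1) * ?a"
        unfolding card[OF A(1)] card[OF \<open>?\<pi> ` A \<subseteq> T\<close>]
        using \<open>finite T\<close> A True s D by (intro sum_transpose_image_le) auto
      then have "real k * ?b \<le> real (M + k - 1) * ?a"
        by (metis of_nat_mono of_nat_mult)
      then have "real k * ?b \<le> (real M + real k - 1) * ?a"
        using M by (simp add: of_nat_diff)
      then show ?thesis unfolding eq using pos \<open>k > 0\<close> by (simp add: field_simps)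
    qed
  qed
  have integrable: "integrable q (\<lambda>A. pmf (g A) x)" for g :: "'a set \<Rightarrow> 'b pmf" and x
    by (rule measure_pmf.integrable_const_bound[where B = 1]) (auto simp: pmf_le_1)
  have "pmf (bind_pmf q ?f) s = (\<integral>A. pmf (?f A) s \<partial>q)"
    by (simp add: pmf_bind)
  also have "\<dots> \<le> (\<integral>A. ?c * pmf (?f (?\<pi> ` A)) s' \<partial>q)"
    using bound integrable[of "\<lambda>A. ?f (?\<pi> ` A)"] integrable[of ?f]
    by (intro integral_mono_AE) (auto simp: AE_measure_pmf_iff)
  also have "\<dots> = ?c * (\<integral>A. pmf (?f (?\<pi> ` A)) s' \<partial>q)"
    by simp
  \<comment> \<open>Change of variables: the exchange moves from the integrand into the measure,
    where \<open>inv\<close> absorbs it.\<close>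
  also have "(\<integral>A. pmf (?f (?\<pi> ` A)) s' \<partial>q) = (\<integral>A. pmf (?f A) s' \<partial>(map_pmf ((`) ?\<pi>) q))"
    by simp
  also have "\<dots> = pmf (bind_pmf q ?f) s'"
    unfolding inv by (simp add: pmf_bind)
  finally show ?thesis .
qed

text \<open>This makes the quotient in the theorem a genuine one, division by 0 being 0. Any set in
  the support has some element \<open>u\<close>; exchanging \<open>u\<close> with \<open>t\<close>
  gives a set in the support that contains \<open>t\<close>.\<close>

lemma pmf_bind_union_pos:
  fixes q :: "'a set pmf" and D :: "'a \<Rightarrow> 'b set"
  assumes "finite T" "k > 0"
    and q: "\<And>A. A \<in> set_pmf q \<Longrightarrow> A \<subseteq> T \<and> card A = min k (card T)"
    and inv: "\<And>u. u \<in> T \<Longrightarrow> map_pmf ((`) (Transposition.transpose u t)) q = q"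
    and D: "\<And>x. x \<in> T \<Longrightarrow> finite (D x)"
    and s: "t \<in> T" "s \<in> D t"
  shows "pmf (bind_pmf q (\<lambda>A. pmf_of_set (\<Union>(D ` A)))) s > 0"
proof -
  obtain A where A: "A \<in> set_pmf q" using set_pmf_not_empty by fast
  then have "A \<subseteq> T" "A \<noteq> {}"
    using q[OF A] s \<open>finite T\<close> \<open>k > 0\<close> by (auto simp: min_def split: if_splits)
  then obtain u where u: "u \<in> A" "u \<in> T" by auto
  define B where "B = Transposition.transpose u t ` A"
  have "B \<in> set_pmf (map_pmf ((`) (Transposition.transpose u t)) q)"
    using A by (simp add: B_def)
  then have "B \<in> set_pmf q" unfolding inv[OF u(2)] .
  have "t \<in> B" using imageI[OF u(1), of "Transposition.transpose u t"] by (simp add: B_def)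
  have "finite (\<Union>(D ` B))"
    using q[OF \<open>B \<in> set_pmf q\<close>] D \<open>finite T\<close> by (auto intro: finite_subset)
  then have "s \<in> set_pmf (pmf_of_set (\<Union>(D ` B)))"
    using \<open>t \<in> B\<close> s by (subst set_pmf_of_set) auto
  then have "s \<in> set_pmf (bind_pmf q (\<lambda>A. pmf_of_set (\<Union>(D ` A))))"
    using \<open>B \<in> set_pmf q\<close> by auto
  then show ?thesis by (simp add: pmf_positive)
qed

section \<open>Pseudosolutions, their descendants and the two-sided bound\<close>

lemma finite_pseudosolutions: "finite (pseudosolutions n F i)"
  by (rule finite_subset[OF _ finite_lists_length_eq[of "UNIV :: bool set" i]])
    (auto simp: pseudosolutions_def)

lemma take_in_pseudosolutions:
  assumes "u \<in> pseudosolutions n F (i + l)"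
  shows "take i u \<in> pseudosolutions n F i"
proof -
  obtain v where "length u = i + l" "u @ v \<in> solutions n F"
    using assms by (auto simp: pseudosolutions_def)
  then have "length (take i u) = i" "take i u @ (drop i u @ v) \<in> solutions n F"
    by (simp_all flip: append_assoc)
  then show ?thesis unfolding pseudosolutions_def by blast
qed

lemma in_descendants_take:
  assumes "u \<in> pseudosolutions n F (i + l)"
  shows "u \<in> descendants n F l (take i u)"
  using assms by (auto simp: descendants_def pseudosolutions_def)

lemma finite_descendants: "finite (descendants n F l t)"
  using finite_pseudosolutions by (auto simp: descendants_def)

text \<open>With the prefix \<open>t\<close> fixed, only the last \<open>l\<close> truth values are
  free.\<close>

lemma card_descendants_le: "card (descendants n F l t) \<le> 2 ^ l"
proof -
  have "card (descendants n F l t) \<le> card {v :: bool list. set v \<subseteq> UNIV \<and> length v = l}"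
  proof (rule card_inj_on_le)
    show "inj_on (drop (length t)) (descendants n F l t)"
      by (rule inj_onI) (metis (mono_tags, lifting) append_take_drop_id descendants_def mem_Collect_eq)
    show "drop (length t) ` descendants n F l t \<subseteq> {v. set v \<subseteq> UNIV \<and> length v = l}"
      by (auto simp: descendants_def pseudosolutions_def)
  qed (rule finite_lists_length_eq, simp)
  then show ?thesis using card_lists_length_eq[of "UNIV :: bool set" l] by simp
qed

text \<open>A completion of \<open>t\<close> has n - i \<ge> l entries; its first \<open>l\<close>
  extend \<open>t\<close> and the others witness that the extension can be completed.\<close>

lemma descendants_nonempty:
  assumes "t \<in> pseudosolutions n F i" "i + l \<le> n"
  shows "descendants n F l t \<noteq> {}"
proof -
  obtain u where u: "length t = i" "t @ u \<in> solutions n F"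
    using assms by (auto simp: pseudosolutions_def)
  then have "length u = n - i" by (auto simp: solutions_def)
  then have "t @ take l u \<in> pseudosolutions n F (i + l)"
    using u assms(2) by (auto simp: pseudosolutions_def intro!: exI[of _ "drop l u"])
  then show ?thesis using u by (auto simp: descendants_def)
qed

lemma disjoint_descendants:
  "disjoint_family_on (descendants n F l) (pseudosolutions n F i)"
  by (auto simp: disjoint_family_on_def descendants_def pseudosolutions_def)

theorem theorem1:
  fixes F :: cnf and n i l k M :: nat
    and p :: "bool list set pmf"
    and s s' :: "bool list"
  assumes "cnf_over n F"
    and "l \<ge> 1" and "i + l \<le> n"
    and "M = 2 ^ l"
    and "k > 1"
    and "uniformly_sampled (pseudosolutions n F i) p"
    and "\<And>\<Phi>. \<Phi> \<in> set_pmf p \<Longrightarrow> card \<Phi> \<ge> min k (card (pseudosolutions n F i))"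
    and "s \<in> pseudosolutions n F (i + l)" and "s' \<in> pseudosolutions n F (i + l)"
  shows "real k / (real M + real k - 1)
           \<le> pmf (black_box_draw n F p k l) s / pmf (black_box_draw n F p k l) s'
       \<and> pmf (black_box_draw n F p k l) s / pmf (black_box_draw n F p k l) s'
           \<le> (real M + real k - 1) / real k"
proof -
  let ?T = "pseudosolutions n F i" and ?D = "descendants n F l"
  \<comment> \<open>The law of the set of ancestors drawn, with the randomness of the input set
    included.\<close>
  define q where "q = bind_pmf p (\<lambda>\<Phi>. draw_loop (min k (card \<Phi>)) \<Phi> {})"
  let ?P = "bind_pmf q (\<lambda>A. pmf_of_set (\<Union>(?D ` A)))"
  have draw: "black_box_draw n F p k l = ?P"
    unfolding black_box_draw_def black_box_sampler_def q_def
    using sampler_loop_eq_map_draw_loop[of ?D _ _ "{}"]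
    by (simp add: bind_assoc_pmf bind_map_pmf)
  have sub: "\<Phi> \<subseteq> ?T" "finite \<Phi>" if "\<Phi> \<in> set_pmf p" for \<Phi>
    using assms(6) that finite_subset[OF _ finite_pseudosolutions]
    by (auto simp: uniformly_sampled_def)
  have q: "A \<subseteq> ?T \<and> card A = min k (card ?T)" if A: "A \<in> set_pmf q" for A
  proof -
    obtain \<Phi> where \<Phi>: "\<Phi> \<in> set_pmf p" "A \<in> set_pmf (draw_loop (min k (card \<Phi>)) \<Phi> {})"
      using A unfolding q_def set_bind_pmf by blast
    have "A \<subseteq> {} \<union> \<Phi> \<and> card A = card ({} :: bool list set) + min k (card \<Phi>)"
      using \<Phi> sub by (intro set_draw_loop) auto
    \<comment> \<open>Together with the assumed lower bound on \<open>card \<Phi>\<close>, this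
      makes the number of draws the same for every input set.\<close>
    moreover have "card \<Phi> \<le> card ?T"
      using finite_pseudosolutions sub(1)[OF \<Phi>(1)] by (rule card_mono)
    ultimately show ?thesis
      using assms(7)[OF \<Phi>(1)] sub(1)[OF \<Phi>(1)] by (auto simp: min_def split: if_splits)
  qed
  have inv: "map_pmf ((`) (Transposition.transpose u v)) q = q" if "u \<in> ?T" "v \<in> ?T" for u v
  proof -
    let ?\<pi> = "Transposition.transpose u v"
    \<comment> \<open>The exchange passes through the draws to the input set, whose law it
      preserves.\<close>
    have "map_pmf ((`) ?\<pi>) q
        = bind_pmf p (\<lambda>\<Phi>. draw_loop (min k (card (?\<pi> ` \<Phi>))) (?\<pi> ` \<Phi>) {})"
      unfolding q_def map_bind_pmf
      using sub by (intro bind_pmf_cong refl) (subst map_draw_loop, auto simp: card_image)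
    also have "\<dots> = bind_pmf (map_pmf ((`) ?\<pi>) p) (\<lambda>\<Phi>. draw_loop (min k (card \<Phi>)) \<Phi> {})"
      by (simp add: bind_map_pmf)
    also have "map_pmf ((`) ?\<pi>) p = p"
      using assms(6) finite_pseudosolutions that
      by (intro uniformly_sampled_image_invariant[where A = ?T] transpose_image_eq) auto
    finally show ?thesis by (simp add: q_def)
  qed
  have D: "finite (?D x) \<and> 1 \<le> card (?D x) \<and> card (?D x) \<le> M" if "x \<in> ?T" for x
    using descendants_nonempty[OF that assms(3)] finite_descendants[of n F l x]
      card_descendants_le[of n F l x] assms(4) by (simp add: Suc_le_eq card_gt_0_iff)
  note anc = take_in_pseudosolutions in_descendants_take
  have le: "pmf ?P u \<le> (real M + real k - 1) / real k * pmf ?P v"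
    if "u \<in> pseudosolutions n F (i + l)" "v \<in> pseudosolutions n F (i + l)" for u v
    using that inv q D disjoint_descendants finite_pseudosolutions assms(5)
    by (intro pmf_bind_union_le[where T = ?T and t = "take i u" and t' = "take i v"])
      (auto intro: anc)
  have pos: "pmf ?P s' > 0"
    using assms inv q finite_pseudosolutions finite_descendants
    by (intro pmf_bind_union_pos[where T = ?T and t = "take i s'" and k = k])
      (auto intro: anc)
  have "real M + real k - 1 > 0" using assms(5) by linarith
  \<comment> \<open>The bound for \<open>s\<close> against \<open>s'\<close> is the upper estimate;
    with the roles swapped it gives the lower one.\<close>
  then show ?thesis
    using le[OF assms(8,9)] le[OF assms(9,8)] pos assms(5) unfolding draw
    by (auto simp: field_simps)
qed

end
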